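(* Let $\mathbf{N}$ denote the set of positive integers and $\mathbf{Q}$ the set of rational numbers. Let $S = \mathcal{I} \cap \mathbf{Q}$, where $\mathcal{I} \subseteq \mathbf{R}$ is an interval (open, closed, or half-open) with nonempty interior. If $f:\mathbf{N} \rightarrow S$ is surjective, then for no positive integer $k$ is $f$ $k$-monotonic; that is, for every positive integer $k$ there do not exist subsets $X_1, \ldots, X_k \subseteq \mathbf{N}$ with $\mathbf{N} = X_1 \cup \cdots \cup X_k$ such that for each $i$ the restriction $f|X_i$ is monotonically increasing or monotonically decreasing.
   Context: A function $g: A \rightarrow B$ between ordered sets is monotonically increasing if $x \leq x'$ implies $g(x) \leq g(x')$, and monotonically decreasing if $x \leq x'$ implies $g(x) \geq g(x')$. The function $f$ is called $k$-monotonic if its domain is a union of $k$ subsets on each of which $f$ is monotonically increasing or monotonically decreasing. *)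

theory Defs
  imports "HOL-Analysis.Analysis"
begin

definition k_monotonic_on :: "nat \<Rightarrow> 'a::order set \<Rightarrow> ('a \<Rightarrow> 'b::order) \<Rightarrow> bool" where
  "k_monotonic_on k A f \<longleftrightarrow>
    (\<exists>X :: nat \<Rightarrow> 'a set. A = (\<Union>i\<in>{1..k}. X i) \<and>
      (\<forall>i\<in>{1..k}. mono_on (X i) f \<or> antimono_on (X i) f))"

end

theory Submission
  imports Defs
begin

text \<open>
  Every element of the image of a monotone function on a set of naturals has only finitely many
  elements of the image on one of its sides, so such an image is nowhere dense. Nowhere dense sets
  are closed under finite unions, whereas the rationals of a nondegenerate interval are
  somewhere dense.
\<close>

text \<open>A nonempty open subset of \<open>closure Y\<close> would contain some \<open>y\<close>
  in \<open>Y\<close>. Cutting it at \<open>y\<close>, on the side with finitely many points of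
  \<open>Y\<close>, leaves a nonempty open set that is finite, which is impossible in the
  reals.\<close>

lemma interior_closure_empty_if_finite_one_side:
  fixes Y :: "real set"
  assumes "\<And>y. y \<in> Y \<Longrightarrow> finite (Y \<inter> {..<y}) \<or> finite (Y \<inter> {y<..})"
  shows "interior (closure Y) = {}"
proof (rule ccontr)
  define U where "U = interior (closure Y)"
  assume "interior (closure Y) \<noteq> {}"
  then have U: "open U" "U \<noteq> {}" "U \<subseteq> closure Y"
    by (auto simp: U_def interior_subset)
  then obtain y where y: "y \<in> U" "y \<in> Y"
    using open_Int_closure_eq_empty[of U Y] by blast
  \<comment> \<open>\<open>V\<close> stands for either open ray at \<open>y\<close>; since
    \<open>y\<close> is in its closure, the neighbourhood \<open>U\<close> of \<open>y\<close> meets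
    it.\<close>
  have False if V: "open V" "finite (Y \<inter> V)" "y \<in> closure V" for V
  proof -
    have ne: "U \<inter> V \<noteq> {}"
      using open_Int_closure_eq_empty[OF U(1), of V] y V(3) by blast
    have op: "open (U \<inter> V)"
      using U(1) V(1) by blast
    have "U \<inter> V \<subseteq> closure (V \<inter> Y)"
      using open_Int_closure_subset[OF V(1), of Y] U(3) by blast
    also have "\<dots> = V \<inter> Y"
      using V(2) by (simp add: Int_commute finite_imp_closed)
    finally have "finite (U \<inter> V)"
      using V(2) by (metis Int_commute finite_subset)
    then show False
      using op ne by (metis finite_imp_not_open)
  qed
  from this[of "{..<y}"] this[of "{y<..}"] assms[OF y(2)] show False
    by auto
qed

text \<open>Only finitely many indices precede \<open>n\<close>, and these alone can give values
  below \<open>f n\<close> in the increasing case, or above \<open>f n\<close> in the decreasing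
  case.\<close>

lemma interior_closure_mono_image_nat:
  fixes f :: "nat \<Rightarrow> real"
  assumes "mono_on X f \<or> antimono_on X f"
  shows "interior (closure (f ` X)) = {}"
proof (rule interior_closure_empty_if_finite_one_side)
  fix y assume "y \<in> f ` X"
  then obtain n where n: "n \<in> X" "y = f n" by blast
  from assms show "finite (f ` X \<inter> {..<y}) \<or> finite (f ` X \<inter> {y<..})"
  proof
    assume "mono_on X f"
    have "f ` X \<inter> {..<y} \<subseteq> f ` {..<n}"
    proof
      fix z assume "z \<in> f ` X \<inter> {..<y}"
      then obtain m where m: "m \<in> X" "z = f m" "f m \<in> {..<y}" by blast
      then have "m < n"
        using monotone_onD[OF \<open>mono_on X f\<close> n(1), of m] n(2) by (cases "m < n") auto
      then show "z \<in> f ` {..<n}" using m(2) by simp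
    qed
    then show ?thesis
      by (meson finite_imageI finite_lessThan finite_subset)
  next
    assume "antimono_on X f"
    have "f ` X \<inter> {y<..} \<subseteq> f ` {..<n}"
    proof
      fix z assume "z \<in> f ` X \<inter> {y<..}"
      then obtain m where m: "m \<in> X" "z = f m" "f m \<in> {y<..}" by blast
      then have "m < n"
        using monotone_onD[OF \<open>antimono_on X f\<close> n(1), of m] n(2) by (cases "m < n") auto
      then show "z \<in> f ` {..<n}" using m(2) by simp
    qed
    then show ?thesis
      by (meson finite_imageI finite_lessThan finite_subset)
  qed
qed

text \<open>Adjoining a set with empty interior to a closed set adds no interior points. Taking
  closures is essential: the rationals and the irrationals both have empty interior, but their union
  does not.\<close>

lemma interior_closure_Union_empty:
  assumes "finite A" and "\<And>i. i \<in> A \<Longrightarrow> interior (closure (Y i)) = {}"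
  shows "interior (closure (\<Union>i\<in>A. Y i)) = {}"
  using assms
  by (induction A rule: finite_induct) (simp_all add: interior_closed_Un_empty_interior)

lemma open_subset_closure_Rats_Int:
  fixes U :: "real set"
  assumes "open U"
  shows "U \<subseteq> closure (U \<inter> \<rat>)"
  using open_Int_closure_subset[OF assms, of \<rat>] by (simp add: Rats_closure_real)

theorem theorem3:
  fixes I S :: "real set" and f :: "nat \<Rightarrow> real"
  assumes "is_interval I" and "interior I \<noteq> {}"
    and "S = I \<inter> \<rat>"
    and "f ` {1..} = S"
  shows "\<forall>k\<ge>1. \<not> k_monotonic_on k {1..} f"
proof (intro allI impI notI)
  fix k :: nat
  assume "k_monotonic_on k {1..} f"
  then obtain X where X: "{1..} = (\<Union>i\<in>{1..k}. X i)"
    and mono: "\<And>i. i \<in> {1..k} \<Longrightarrow> mono_on (X i) f \<or> antimono_on (X i) f"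
    unfolding k_monotonic_on_def by blast
  have "S = (\<Union>i\<in>{1..k}. f ` X i)"
    using assms(4) X by (simp add: image_UN)
  then have "interior (closure S) = {}"
    using interior_closure_Union_empty[of "{1..k}" "\<lambda>i. f ` X i"]
      interior_closure_mono_image_nat[OF mono] by simp
  \<comment> \<open>By density, the open set \<open>interior I\<close> lies in the closure of its
    own rationals, all of which belong to \<open>S\<close>.\<close>
  moreover have "interior I \<subseteq> closure S"
  proof -
    have "interior I \<inter> \<rat> \<subseteq> S"
      using assms(3) interior_subset by blast
    then show ?thesis
      using open_subset_closure_Rats_Int[OF open_interior] closure_mono by (meson order_trans)
  qed
  ultimately show False
    using assms(2) interior_maximal[of "interior I" "closure S"] by simp
qed

end
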